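(* For general nonnegative additive valuations, no deterministic irrevocable online allocation algorithm can guarantee that the accumulated allocation $A^t$ is EF1 after every arriving good $g_t$. That is, for every deterministic irrevocable online allocation algorithm there exist a finite set $N$ of agents, a finite sequence of goods $g_1,\dots,g_T$ with nonnegative values $v_i(g_t)$ ($i\in N$, $1\le t\le T$), and some $t\le T$ such that the accumulated allocation $A^t$ produced by the algorithm is not EF1.
   Context: There is a finite set $N=\{1,\dots,n\}$ of agents, and indivisible goods $g_1,g_2,\dots$ arrive one at a time. Each agent $i$ has a nonnegative additive valuation $v_i(S)=\sum_{g\in S}v_i(g)$. When $g_t$ arrives, its values $(v_i(g_t))_{i\in N}$ are revealed and the good must be assigned immediately and irrevocably to exactly one agent. A deterministic irrevocable online allocation algorithm is a rule that chooses the recipient of $g_t$ as a deterministic function of the agent set and of the information revealed so far (the values of $g_1,\dots,g_t$ and the earlier assignments), with no knowledge of future goods. $A^t=(A^t_1,\dots,A^t_n)$ denotes the accumulated allocation after the first $t$ arrivals, $A^t_i$ being the set of goods among $g_1,\dots,g_t$ assigned to agent $i$. The allocation $A^t$ is EF1 (envy-free up to one good) if for every pair $i,j\in N$ with $A^t_j\neq\emptyset$ there exists $g\in A^t_j$ such that $v_i(A^t_i)\ge v_i(A^t_j\setminus\{g\})$. *)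

theory Defs
  imports Complex_Main
begin

text \<open>
  For given \<open>n\<close> the agent set is \<open>{1..n}\<close>.  Goods are identified with their arrival times
  \<open>1, 2, \<dots>\<close>, and \<open>v i t\<close> is the value of agent \<open>i\<close> for the good arriving at time \<open>t\<close>.
\<close>

type_synonym valuations = "nat \<Rightarrow> nat \<Rightarrow> real"

text \<open>
  A rule maps the number of agents, the values revealed so far and the earlier assignments to
  the recipient of the current good.  When good \<open>t\<close> arrives, the second argument has \<open>t\<close> rows of
  length \<open>n\<close> (row \<open>s\<close> lists the values of agents \<open>1, \<dots>, n\<close> for good \<open>s\<close>) and the third argument
  lists the recipients of goods \<open>1, \<dots>, t - 1\<close>.
\<close>

type_synonym online_rule = "nat \<Rightarrow> real list list \<Rightarrow> nat list \<Rightarrow> nat"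

definition nonneg_valuations :: "nat \<Rightarrow> valuations \<Rightarrow> nat \<Rightarrow> bool" where
  "nonneg_valuations n v T \<longleftrightarrow> (\<forall>i\<in>{1..n}. \<forall>t\<in>{1..T}. 0 \<le> v i t)"

definition revealed :: "nat \<Rightarrow> valuations \<Rightarrow> nat \<Rightarrow> real list list" where
  "revealed n v t = map (\<lambda>s. map (\<lambda>i. v i s) [1..<Suc n]) [1..<Suc t]"

primrec assignments :: "online_rule \<Rightarrow> nat \<Rightarrow> valuations \<Rightarrow> nat \<Rightarrow> nat list" where
  "assignments alg n v 0 = []"
| "assignments alg n v (Suc t) =
     assignments alg n v t @ [alg n (revealed n v (Suc t)) (assignments alg n v t)]"

text \<open>Goods are numbered from 1, list positions from 0.\<close>

definition recipient :: "online_rule \<Rightarrow> nat \<Rightarrow> valuations \<Rightarrow> nat \<Rightarrow> nat" where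
  "recipient alg n v t = assignments alg n v t ! (t - 1)"

text \<open>
  Every arriving good must go to an agent.  This is only required on histories that the rule
  can actually produce.  There is no recipient if \<open>n = 0\<close>, hence \<open>n \<ge> 1\<close>.
\<close>

definition online_algorithm :: "online_rule \<Rightarrow> bool" where
  "online_algorithm alg \<longleftrightarrow>
     (\<forall>n v t. 1 \<le> n \<and> 1 \<le> t \<and> nonneg_valuations n v t \<longrightarrow> recipient alg n v t \<in> {1..n})"

definition allocation :: "online_rule \<Rightarrow> nat \<Rightarrow> valuations \<Rightarrow> nat \<Rightarrow> nat \<Rightarrow> nat set" where
  "allocation alg n v t i = {s\<in>{1..t}. recipient alg n v s = i}"

definition bundle_value :: "valuations \<Rightarrow> nat \<Rightarrow> nat set \<Rightarrow> real" where
  "bundle_value v i S = (\<Sum>g\<in>S. v i g)"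

definition EF1 :: "nat \<Rightarrow> valuations \<Rightarrow> (nat \<Rightarrow> nat set) \<Rightarrow> bool" where
  "EF1 n v A \<longleftrightarrow>
     (\<forall>i\<in>{1..n}. \<forall>j\<in>{1..n}. A j \<noteq> {} \<longrightarrow>
        (\<exists>g\<in>A j. bundle_value v i (A i) \<ge> bundle_value v i (A j - {g})))"

end

theory Submission imports Defs begin

text \<open>
  Two agents suffice.  Good 1 is worth 1 to both; call \<open>a\<close> its recipient and \<open>b\<close> the other agent.
  The next two goods are worth 2 and 2 to \<open>a\<close>, and 1/2 and 1 to \<open>b\<close>.  Good 2 must go to \<open>b\<close>, who
  would otherwise hold nothing against two goods of positive value.  Then each agent values her own
  good less than the other's good and less than good 3, so whoever receives good 3 is envied even
  after the removal of any one good.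
\<close>

lemma allocation_numerals:
  "allocation alg n v 2 i = {s\<in>{1, 2}. recipient alg n v s = i}"
  "allocation alg n v 3 i = {s\<in>{1, 2, 3}. recipient alg n v s = i}"
proof -
  have "{1..2} = {1, 2::nat}" "{1..3} = {1, 2, 3::nat}" by auto
  then show "allocation alg n v 2 i = {s\<in>{1, 2}. recipient alg n v s = i}"
    "allocation alg n v 3 i = {s\<in>{1, 2, 3}. recipient alg n v s = i}"
    unfolding allocation_def by simp_all
qed

lemma not_EF1I:
  assumes "i \<in> {1..n}" "j \<in> {1..n}" "A j \<noteq> {}"
    and "\<And>g. g \<in> A j \<Longrightarrow> bundle_value v i (A i) < bundle_value v i (A j - {g})"
  shows "\<not> EF1 n v A"
  using assms unfolding EF1_def by (meson not_less)

theorem proposition1: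
  fixes alg :: online_rule
  assumes "online_algorithm alg"
  shows "\<exists>n T v. 1 \<le> n \<and> nonneg_valuations n v T \<and>
           (\<exists>t\<in>{1..T}. \<not> EF1 n v (allocation alg n v t))"
proof -
  \<comment> \<open>The valuation below depends on who gets good 1, so \<open>a\<close> is read off
    the rule before \<open>v\<close> exists.\<close>
  define a where "a = alg 2 [[1, 1]] []"
  define b where "b = 3 - a"
  define v :: valuations where
    "v = (\<lambda>i t. if t = 1 then 1 else if i = a then 2 else if t = 2 then 1/2 else 1)"
  have nonneg: "nonneg_valuations 2 v T" for T
    by (auto simp: nonneg_valuations_def v_def)
  have r: "recipient alg 2 v t \<in> {1, 2}" if "1 \<le> t" for t
  proof -
    have "recipient alg 2 v t \<in> {1..2}"
      using assms nonneg that unfolding online_algorithm_def by simp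
    then show ?thesis by auto
  qed
  \<comment> \<open>No circularity: the first row of \<open>v\<close> is \<open>[1, 1]\<close>
    whatever \<open>a\<close> is. The form \<open>Suc 0\<close> is the one to which simp rewrites
    \<open>1\<close>.\<close>
  have r1: "recipient alg 2 v (Suc 0) = a"
    by (simp add: recipient_def a_def revealed_def v_def upt_rec)
  have a: "a \<in> {1, 2}" using r[of 1] r1 by simp
  then have b: "b \<in> {1, 2}" "b \<noteq> a" and ab: "{1, 2} = {a, b}" unfolding b_def by auto
  have vals: "v i (Suc 0) = 1" "v a 2 = 2" "v a 3 = 2" "v b 2 = 1/2" "v b 3 = 1" for i
    using b by (simp_all add: v_def)
  have rng: "a \<in> {1..2}" "b \<in> {1..2}" using a b by auto
  have "\<exists>t\<in>{1..3}. \<not> EF1 2 v (allocation alg 2 v t)"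
  proof (cases "recipient alg 2 v 2 = a")
    case True
    then have A: "allocation alg 2 v 2 a = {1, 2}" "allocation alg 2 v 2 b = {}"
      using b r1 by (auto simp: allocation_numerals)
    \<comment> \<open>\<open>b\<close> has 0; what remains of \<open>a\<close>'s bundle is worth 1/2
      or 1 to \<open>b\<close>.\<close>
    have "\<not> EF1 2 v (allocation alg 2 v 2)"
      by (rule not_EF1I[OF rng(2) rng(1)])
        (auto simp: A bundle_value_def vals insert_Diff_if)
    then show ?thesis by force
  next
    case False
    then have r2: "recipient alg 2 v 2 = b" using r[of 2] ab by auto
    have "recipient alg 2 v 3 = a \<or> recipient alg 2 v 3 = b" using r[of 3] ab by auto
    then have "\<not> EF1 2 v (allocation alg 2 v 3)"
    proof
      assume r3: "recipient alg 2 v 3 = a"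
      then have A: "allocation alg 2 v 3 a = {1, 3}" "allocation alg 2 v 3 b = {2}"
        using b r1 r2 by (auto simp: allocation_numerals)
      \<comment> \<open>\<open>b\<close> envies \<open>a\<close>: 1/2 against a remaining good worth
        1.\<close>
      show ?thesis
        by (rule not_EF1I[OF rng(2) rng(1)])
          (auto simp: A bundle_value_def vals insert_Diff_if)
    next
      assume r3: "recipient alg 2 v 3 = b"
      then have A: "allocation alg 2 v 3 a = {1}" "allocation alg 2 v 3 b = {2, 3}"
        using b r1 r2 by (auto simp: allocation_numerals)
      \<comment> \<open>\<open>a\<close> envies \<open>b\<close>: 1 against a remaining good worth
        2.\<close>
      show ?thesis
        by (rule not_EF1I[OF rng])
          (auto simp: A bundle_value_def vals insert_Diff_if)
    qed
    then show ?thesis by force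
  qed
  then show ?thesis using nonneg one_le_numeral by blast
qed

end
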